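(* Let $m,n\ge 3$ be integers such that $q=2mn+1$ is a prime power, there exist two distinct odd primes $p,p'$ with $p\mid m$ and $p'\mid n$, $m_o\cdot \mathrm{rad}(m_o)$ does not divide $n_o$, and $n_o\cdot\mathrm{rad}(n_o)$ does not divide $m_o$. Then there exists an optimal rank-one Heffter array H$(m,n)$ over $\mathbb{F}_q$, i.e. a rank-one H$(m,n)$ over $\mathbb{F}_q$ whose group of multipliers has order $\mathrm{lcm}(m_o,n_o)$.
   Context: For an integer $k$, $k_o$ denotes its odd part (largest odd divisor), and $\mathrm{rad}(k)$ is the product of the distinct primes dividing $k$ (with $\mathrm{rad}(1)=1$). A half-set of an additive group $G$ of odd order $2\ell+1$ is an $\ell$-subset $L$ with $L\cup -L=G\setminus\{0\}$. A Heffter array H$(m,n)$ over $\mathbb{F}_q$ is an $m\times n$ matrix over $\mathbb{F}_q$ whose entries form a half-set of the additive group of $\mathbb{F}_q$ and whose every row and column sums to $0$; it is rank-one if it has rank $1$ over $\mathbb{F}_q$. A multiplier of such an array $A$ is an element $u\in\mathbb{F}_q^*$ such that $uA$ or $uA^T$ can be obtained from $A$ by permuting its rows and columns; multipliers form a subgroup of $\mathbb{F}_q^*$. *)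

theory Defs
  imports
    "HOL-Number_Theory.Prime_Powers"
    "HOL-Combinatorics.Permutations"
    "Jordan_Normal_Form.DL_Rank"
begin

definition odd_part :: "nat \<Rightarrow> nat" where
  "odd_part k = Max {d. odd d \<and> d dvd k}"

definition rad :: "nat \<Rightarrow> nat" where
  "rad k = \<Prod>(prime_factors k)"

(* The first conjunct says that the ambient group is finite of odd order 2 * l + 1 with
   l = card L: an infinite type has cardinality 0. *)
definition half_set :: "'a::ab_group_add set \<Rightarrow> bool" where
  "half_set L \<longleftrightarrow> card (UNIV :: 'a set) = 2 * card L + 1 \<and> L \<union> uminus ` L = UNIV - {0}"

(* The entries are required to be pairwise distinct since elements_mat A forgets repetitions. *)
definition heffter_array :: "nat \<Rightarrow> nat \<Rightarrow> 'a::field mat \<Rightarrow> bool" where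
  "heffter_array m n A \<longleftrightarrow>
     A \<in> carrier_mat m n \<and>
     inj_on (\<lambda>ij. A $$ ij) ({..<m} \<times> {..<n}) \<and>
     half_set (elements_mat A) \<and>
     (\<forall>i<m. (\<Sum>j<n. A $$ (i, j)) = 0) \<and>
     (\<forall>j<n. (\<Sum>i<m. A $$ (i, j)) = 0)"

(* The columns of A are vectors of dimension dim_row A. *)
definition rank_one :: "'a::field mat \<Rightarrow> bool" where
  "rank_one A \<longleftrightarrow> vec_space.rank (dim_row A) A = 1"

definition perm_rows_cols :: "'a mat \<Rightarrow> 'a mat \<Rightarrow> bool" where
  "perm_rows_cols A B \<longleftrightarrow>
     (\<exists>\<sigma> \<tau>. \<sigma> permutes {..<dim_row A} \<and> \<tau> permutes {..<dim_col A} \<and>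
            B = mat (dim_row A) (dim_col A) (\<lambda>(i, j). A $$ (\<sigma> i, \<tau> j)))"

(* Matrices of different dimensions are unequal, so the transposed case only arises for square A. *)
definition multipliers :: "'a::field mat \<Rightarrow> 'a set" where
  "multipliers A =
     {u. u \<noteq> 0 \<and> (perm_rows_cols A (u \<cdot>\<^sub>m A) \<or> perm_rows_cols A (u \<cdot>\<^sub>m transpose_mat A))}"

end

(* Write the array as A = x y^T. Choose coprime h | m_o and k | n_o with h k = lcm(m_o, n_o) and
   h, k > 1: a prime goes into the factor whose index contains it to the higher power, and the
   divisibility hypotheses together with the two distinct primes make it possible to break ties
   so that both factors are nontrivial. Let x list a union of m/h cosets of the group of h-th
   roots of unity and y a union of n/k cosets of the group of k-th roots of unity, with
   representatives 1, g, ..., g^(r-1) and 1, g^r, ..., g^(r(s-1)), where r = m/h, s = n/k and g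
   generates the multiplicative group. Then each element of F_q^* is a product x_i y_j up to
   sign in exactly one way, and the sums over x and y vanish because each of the two sets is
   invariant under some root of unity other than 1. A multiplier is a product of a stabilizer
   of x and one of y; the former have odd order dividing m since no power of them is -1, and the
   latter likewise n, so the multipliers are exactly the lcm(m_o, n_o)-th roots of unity. *)
theory Submission
  imports Defs "HOL-Algebra.Multiplicative_Group" "HOL-Number_Theory.Cong"
begin

section \<open>Odd parts and a coprime factorization of their least common multiple\<close>

lemma odd_part_eq:
  assumes "odd l"
  shows "odd_part (2 ^ t * l) = l"
  unfolding odd_part_def
proof (rule Max_eqI)
  have "l > 0" using assms by (rule odd_pos)
  then have "{d. odd d \<and> d dvd 2 ^ t * l} \<subseteq> {..2 ^ t * l}"
    by (auto intro!: dvd_imp_le)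
  then show "finite {d. odd d \<and> d dvd 2 ^ t * l}" by (rule finite_subset) simp
  fix d assume "d \<in> {d. odd d \<and> d dvd 2 ^ t * l}"
  then have d: "odd d" "d dvd 2 ^ t * l" by auto
  then have "coprime d (2 ^ t)" by simp
  with d have "d dvd l" using coprime_dvd_mult_right_iff by blast
  then show "d \<le> l" using \<open>l > 0\<close> by (rule dvd_imp_le)
qed (use assms in auto)

lemma odd_part_decompose:
  assumes "k > 0"
  obtains t where "k = 2 ^ t * odd_part k" and "odd (odd_part k)"
proof -
  obtain l where "k = 2 ^ multiplicity 2 k * l" "\<not> 2 dvd l"
    using multiplicity_decompose'[of k 2] assms by auto
  then show thesis using that odd_part_eq by metis
qed

text \<open>Multiplying \<open>M\<close> by \<open>rad M\<close> raises the multiplicity of each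
  prime of \<open>M\<close> by exactly one. Non-divisibility thus yields a prime whose multiplicity
  in \<open>K\<close> is less than one more than that in \<open>M\<close>; a prime outside
  \<open>M\<close> would need a negative multiplicity in \<open>K\<close>.\<close>

lemma exists_prime_multiplicity_ge:
  assumes "M > 0" "K > 0" "\<not> M * rad M dvd K"
  obtains p where "p \<in> prime_factors M" "multiplicity p K \<le> multiplicity p M"
proof -
  have rad: "rad M = (\<Prod>p\<in>prime_factors M. p ^ 1)" by (simp add: rad_def)
  have "rad M \<noteq> 0" by (auto simp: rad_def)
  have "\<exists>p. prime p \<and> \<not> multiplicity p (M * rad M) \<le> multiplicity p K"
    using multiplicity_le_imp_dvd[of "M * rad M" K] assms \<open>rad M \<noteq> 0\<close> by auto
  then obtain p where p: "prime p" "multiplicity p K < multiplicity p (M * rad M)"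
    by (auto simp: not_le)
  have "multiplicity p (rad M) = (if p \<in> prime_factors M then 1 else 0)"
    unfolding rad by (rule multiplicity_prod_prime_powers) (use p in auto)
  then have *: "multiplicity p (M * rad M) =
      multiplicity p M + (if p \<in> prime_factors M then 1 else 0)"
    using p assms \<open>rad M \<noteq> 0\<close> by (simp add: prime_elem_multiplicity_mult_distrib)
  show thesis
  proof (cases "p \<in> prime_factors M")
    case True
    then show thesis using that[of p] p * by auto
  next
    case False
    then have "multiplicity p M = 0"
      using p(1) by (auto simp: prime_factors_multiplicity)
    then show thesis using p * False by simp
  qed
qed

lemma coprime_factorization_of_lcm:
  fixes M K :: nat
  assumes "M > 0" "K > 0" "\<not> M * rad M dvd K" "\<not> K * rad K dvd M"
    and "prime p" "prime p'" "p \<noteq> p'" "p dvd M" "p' dvd K"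
  obtains h k where "h dvd M" "k dvd K" "coprime h k" "h * k = lcm M K" "h > 1" "k > 1"
proof -
  \<comment> \<open>\<open>S\<close> holds the primes that may go into \<open>h\<close>,
    \<open>T\<close> those that may go into \<open>k\<close>; ties lie in both.\<close>
  define S where "S = {r \<in> prime_factors M. multiplicity r K \<le> multiplicity r M}"
  define T where "T = {r \<in> prime_factors K. multiplicity r M \<le> multiplicity r K}"
  obtain a0 where a0: "a0 \<in> S"
    using exists_prime_multiplicity_ge[OF assms(1,2,3)] unfolding S_def by blast
  obtain b0 where b0: "b0 \<in> T"
    using exists_prime_multiplicity_ge[OF assms(2,1,4)] unfolding T_def by blast
  have pf: "r \<in> prime_factors k \<longleftrightarrow> prime r \<and> multiplicity r k > 0" for r k :: nat
    by (simp add: prime_factors_multiplicity)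
  have "p \<in> prime_factors M" "p' \<in> prime_factors K"
    using assms by (auto simp: prime_factors_dvd)
  then have pp: "p \<in> S \<union> T" "p' \<in> S \<union> T"
    unfolding S_def T_def pf by auto
  \<comment> \<open>If \<open>a0 = b0\<close>, at least one of \<open>p\<close>, \<open>p'\<close>
    differs from it and can replace \<open>a0\<close> when it lies in \<open>S\<close>, or
    \<open>b0\<close> when it lies in \<open>T\<close>.\<close>
  obtain a b where ab: "a \<in> S" "b \<in> T" "a \<noteq> b"
    using pp a0 b0 \<open>p \<noteq> p'\<close> by blast
  \<comment> \<open>Ties go to \<open>h\<close>, except that \<open>b\<close> is reserved for
    \<open>k\<close>. Then \<open>a\<close> keeps \<open>h\<close> above 1 and \<open>b\<close>
    keeps \<open>k\<close> above 1.\<close>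
  define U where "U = {r \<in> S. r \<noteq> b}"
  define V where "V = prime_factors K - U"
  define h where "h = (\<Prod>r\<in>U. r ^ multiplicity r M)"
  define k where "k = (\<Prod>r\<in>V. r ^ multiplicity r K)"
  have fin: "finite U" "finite V" unfolding U_def V_def S_def by auto
  have pr: "prime r" if "r \<in> U \<or> r \<in> V" for r
    using that unfolding U_def V_def S_def by auto
  have "h > 0" "k > 0"
    unfolding h_def k_def by (auto intro!: prod_pos simp: pr prime_gt_0_nat)
  have mh: "multiplicity r h = (if r \<in> U then multiplicity r M else 0)" if "prime r" for r
    unfolding h_def by (rule multiplicity_prod_prime_powers) (use fin pr that in auto)
  have mk: "multiplicity r k = (if r \<in> V then multiplicity r K else 0)" if "prime r" for r
    unfolding k_def by (rule multiplicity_prod_prime_powers) (use fin pr that in auto)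
  have mhk: "multiplicity r (h * k) = multiplicity r h + multiplicity r k" if "prime r" for r
    using that \<open>h > 0\<close> \<open>k > 0\<close> by (simp add: prime_elem_multiplicity_mult_distrib)
  have h: "h dvd M"
    by (rule multiplicity_le_imp_dvd) (use \<open>h > 0\<close> mh in auto)
  have k: "k dvd K"
    by (rule multiplicity_le_imp_dvd) (use \<open>k > 0\<close> mk in auto)
  have "coprime h k"
    unfolding h_def k_def
  proof (intro prod_coprime_left prod_coprime_right)
    fix r s assume "r \<in> U" "s \<in> V"
    moreover from this have "r \<noteq> s" by (auto simp: V_def)
    ultimately have "coprime r s" using pr primes_coprime by blast
    then show "coprime (r ^ multiplicity r M) (s ^ multiplicity s K)" by simp
  qed
  moreover have "h * k = lcm M K"
  proof (rule dvd_antisym)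
    show "h * k dvd lcm M K"
      using \<open>coprime h k\<close> h k by (meson divides_mult dvd_lcm1 dvd_lcm2 dvd_trans)
    have "M dvd h * k"
    proof (rule multiplicity_le_imp_dvd)
      fix r :: nat assume r: "prime r"
      show "multiplicity r M \<le> multiplicity r (h * k)"
        using r ab unfolding mhk[OF r] mh[OF r] mk[OF r]
        by (auto simp: U_def V_def S_def T_def pf)
    qed (use assms in auto)
    moreover have "K dvd h * k"
    proof (rule multiplicity_le_imp_dvd)
      fix r :: nat assume r: "prime r"
      show "multiplicity r K \<le> multiplicity r (h * k)"
        using r unfolding mhk[OF r] mh[OF r] mk[OF r]
        by (auto simp: U_def V_def S_def pf)
    qed (use assms in auto)
    ultimately show "lcm M K dvd h * k" by simp
  qed
  moreover have "h > 1"
  proof -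
    have a: "prime a" "multiplicity a h > 0"
      using ab mh[of a] by (auto simp: U_def S_def pf)
    have "h \<noteq> 1"
    proof
      assume "h = 1"
      then show False using a by simp
    qed
    then show ?thesis using \<open>h > 0\<close> by simp
  qed
  moreover have "k > 1"
  proof -
    have a: "prime b" "multiplicity b k > 0"
      using ab mk[of b] by (auto simp: U_def V_def T_def pf)
    have "k \<noteq> 1"
    proof
      assume "k = 1"
      then show False using a by simp
    qed
    then show ?thesis using \<open>k > 0\<close> by simp
  qed
  ultimately show thesis using that h k by blast
qed

section \<open>Generators and roots of unity in a finite field\<close>

lemma finite_field_generator:
  obtains g :: "'a::{finite, field}" where "g \<noteq> 0" "\<forall>x. x \<noteq> 0 \<longrightarrow> (\<exists>i. x = g ^ i)"
proof -
  let ?R = "class_ring :: 'a ring"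
  have pow: "a [^]\<^bsub>mult_of ?R\<^esub> (i::nat) = a ^ i"
    "a [^]\<^bsub>?R\<^esub> (i::nat) = a ^ i" for a :: 'a and i
    by (induction i) (simp_all add: class_ring_simps nat_pow_def)
  have carrier: "carrier (mult_of ?R) = UNIV - {0}" by (simp add: class_ring_simps)
  have "field ?R" by (rule class_field)
  then have "\<exists>a\<in>carrier (mult_of ?R).
      carrier (mult_of ?R) = {a [^]\<^bsub>?R\<^esub> i | i::nat. i \<in> UNIV}"
    by (rule field.finite_field_mult_group_has_gen) simp
  then obtain g :: 'a where "g \<noteq> 0" and gen: "UNIV - {0} = {g ^ i | i. i \<in> UNIV}"
    unfolding pow carrier by blast
  have "\<forall>x. x \<noteq> 0 \<longrightarrow> (\<exists>i. x = g ^ i)"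
  proof (intro allI impI)
    fix x :: 'a assume "x \<noteq> 0"
    then have "x \<in> {g ^ i | i. i \<in> UNIV}" unfolding gen[symmetric] by simp
    then show "\<exists>i. x = g ^ i" by simp
  qed
  with \<open>g \<noteq> 0\<close> show thesis by (rule that)
qed

text \<open>Multiplication by \<open>x\<close> permutes the nonzero elements, so it leaves their
  product unchanged.\<close>

lemma power_card_minus_1:
  fixes x :: "'a::{finite, field}"
  assumes "x \<noteq> 0"
  shows "x ^ (card (UNIV :: 'a set) - 1) = 1"
proof -
  let ?P = "\<Prod>y\<in>UNIV - {0::'a}. y"
  have "(\<Prod>y\<in>UNIV - {0}. x * y) = ?P"
    by (rule prod.reindex_bij_witness[where i = "\<lambda>y. y / x" and j = "\<lambda>y. x * y"])
       (use assms in auto)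
  then have "x ^ card (UNIV - {0::'a}) * ?P = ?P" by (simp add: prod.distrib)
  then show ?thesis by (simp add: card_Diff_singleton)
qed

lemma power_eq_power_cong:
  fixes u :: "'a::monoid_mult"
  assumes "u ^ n = 1" "[i = j] (mod n)"
  shows "u ^ i = u ^ j"
proof -
  have "u ^ i = u ^ (i mod n)" for i
  proof -
    have "u ^ i = u ^ (n * (i div n) + i mod n)" by simp
    also have "\<dots> = u ^ (i mod n)" unfolding power_add power_mult assms by simp
    finally show ?thesis .
  qed
  then show ?thesis using assms(2) unfolding cong_def by metis
qed

text \<open>The powers with exponent below \<open>N\<close> already cover all \<open>N\<close>
  nonzero elements, so by counting they are pairwise distinct.\<close>

lemma generator_power_eq_iff:
  fixes g :: "'a::{finite, field}"
  assumes "g \<noteq> 0" "\<forall>x. x \<noteq> 0 \<longrightarrow> (\<exists>i. x = g ^ i)" "card (UNIV :: 'a set) = Suc N"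
  shows "g ^ i = g ^ j \<longleftrightarrow> [i = j] (mod N)"
proof
  have gN: "g ^ N = 1" using power_card_minus_1[OF assms(1)] assms(3) by simp
  have "card {0, 1 :: 'a} \<le> card (UNIV :: 'a set)" by (rule card_mono) auto
  then have "N > 0" using assms(3) by simp
  have red: "g ^ i = g ^ (i mod N)" for i
    by (rule power_eq_power_cong[OF gN]) (simp add: cong_def)
  have "UNIV - {0} \<subseteq> (\<lambda>i. g ^ i) ` {..<N}"
  proof
    fix x :: 'a assume "x \<in> UNIV - {0}"
    then obtain i where "x = g ^ i" using assms(2) by blast
    then have "x = g ^ (i mod N)" using red by metis
    then show "x \<in> (\<lambda>i. g ^ i) ` {..<N}" using \<open>N > 0\<close> by auto
  qed
  then have "card (UNIV - {0::'a}) \<le> card ((\<lambda>i. g ^ i) ` {..<N})"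
    by (rule card_mono[rotated]) simp
  then have "card ((\<lambda>i. g ^ i) ` {..<N}) = card {..<N}"
    using assms(3) card_image_le[of "{..<N}" "\<lambda>i. g ^ i"] by (simp add: card_Diff_singleton)
  then have inj: "inj_on (\<lambda>i. g ^ i) {..<N}" by (rule eq_card_imp_inj_on[rotated]) simp
  show "[i = j] (mod N)" if "g ^ i = g ^ j"
    using inj_onD[OF inj, of "i mod N" "j mod N"] red[of i] red[of j] that \<open>N > 0\<close>
    by (simp add: cong_def)
  show "g ^ i = g ^ j" if "[i = j] (mod N)"
    using power_eq_power_cong[OF gN that] .
qed

text \<open>For \<open>u = g ^ i\<close> the condition says that \<open>e * h\<close> divides
  \<open>i * h\<close>, that is, \<open>e\<close> divides \<open>i\<close>.\<close>

lemma root_of_unity_iff_generator_power: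
  fixes g :: "'a::{finite, field}"
  assumes "g \<noteq> 0" "\<forall>x. x \<noteq> 0 \<longrightarrow> (\<exists>i. x = g ^ i)" "card (UNIV :: 'a set) = Suc (e * h)"
    and "h > 0"
  shows "u ^ h = 1 \<longleftrightarrow> (\<exists>t. u = g ^ (e * t))"
proof
  assume u: "u ^ h = 1"
  then have "u \<noteq> 0" using \<open>h > 0\<close> by (auto simp: power_0_left)
  then obtain i where i: "u = g ^ i" using assms(2) by blast
  then have "g ^ (i * h) = g ^ 0" using u by (simp add: power_mult)
  then have "[i * h = 0] (mod (e * h))" by (simp only: generator_power_eq_iff[OF assms(1-3)])
  then have "e * h dvd i * h" by (simp add: cong_0_iff)
  then have "e dvd i" using \<open>h > 0\<close> by simp
  then show "\<exists>t. u = g ^ (e * t)" using i by blast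
next
  assume "\<exists>t. u = g ^ (e * t)"
  then obtain t where "u = g ^ (e * t)" by blast
  then have "u ^ h = (g ^ (e * h)) ^ t" by (simp flip: power_mult add: ac_simps)
  then show "u ^ h = 1" using power_card_minus_1[OF assms(1)] assms(3) by simp
qed

lemma card_roots_of_unity:
  assumes "card (UNIV :: 'a::{finite, field} set) = Suc (e * h)"
  shows "card {u :: 'a. u ^ h = 1} = h"
proof -
  obtain g :: 'a where g: "g \<noteq> 0" "\<forall>x. x \<noteq> 0 \<longrightarrow> (\<exists>i. x = g ^ i)"
    using finite_field_generator by blast
  have "card {0, 1 :: 'a} \<le> card (UNIV :: 'a set)" by (rule card_mono) auto
  then have pos: "e > 0" "h > 0" using assms by auto
  note cong = generator_power_eq_iff[OF g assms]
  note root = root_of_unity_iff_generator_power[OF g assms \<open>h > 0\<close>]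
  have "{u. u ^ h = 1} = (\<lambda>t. g ^ (e * t)) ` {..<h}"
  proof (intro equalityI subsetI)
    fix u :: 'a assume "u \<in> {u. u ^ h = 1}"
    then obtain t where t: "u = g ^ (e * t)" using root by auto
    moreover have "[e * t = e * (t mod h)] (mod (e * h))"
      unfolding cong_def mult_mod_right[symmetric] by simp
    ultimately have "u = g ^ (e * (t mod h))"
      using cong by blast
    then show "u \<in> (\<lambda>t. g ^ (e * t)) ` {..<h}" using pos by auto
  qed (use root in auto)
  moreover have "inj_on (\<lambda>t. g ^ (e * t)) {..<h}"
  proof (rule inj_onI)
    fix s t assume st: "s \<in> {..<h}" "t \<in> {..<h}" "g ^ (e * s) = g ^ (e * t)"
    from st(3) have "e * (s mod h) = e * (t mod h)"
      unfolding cong unfolding cong_def mult_mod_right .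
    then show "s = t" using st pos by simp
  qed
  ultimately show ?thesis by (simp add: card_image)
qed

section \<open>Families whose values are permuted by a scaling\<close>

text \<open>Turns invariance of a set of values into a permutation of indices: an injective self-map
  of a finite set is bijective.\<close>

lemma scaling_permutation:
  fixes x :: "'i \<Rightarrow> 'a::field"
  assumes "finite S" "inj_on x S" "c \<noteq> 0" "\<And>i. i \<in> S \<Longrightarrow> c * x i \<in> x ` S"
  obtains \<sigma> where "\<sigma> permutes S" "\<And>i. i \<in> S \<Longrightarrow> x (\<sigma> i) = c * x i"
proof -
  have "\<forall>i\<in>S. \<exists>j\<in>S. x j = c * x i" using assms(4) by (metis imageE)
  then obtain f where f: "\<And>i. i \<in> S \<Longrightarrow> f i \<in> S \<and> x (f i) = c * x i" by metis
  have "inj_on f S"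
  proof (rule inj_onI)
    fix i j assume ij: "i \<in> S" "j \<in> S" "f i = f j"
    then have "c * x i = c * x j" using f by metis
    then show "i = j" using ij \<open>c \<noteq> 0\<close> \<open>inj_on x S\<close> by (auto dest: inj_onD)
  qed
  then have "bij_betw f S S"
    using f \<open>finite S\<close> endo_inj_surj[of S f] by (auto simp: bij_betw_def)
  then have "bij_betw (\<lambda>i. if i \<in> S then f i else i) S S"
    by (subst bij_betw_cong[of S _ f]) auto
  then have "(\<lambda>i. if i \<in> S then f i else i) permutes S"
    by (rule bij_imp_permutes) auto
  then show thesis using that f by simp
qed

lemma sum_eq_0_if_scaling:
  fixes x :: "'i \<Rightarrow> 'a::field"
  assumes "\<sigma> permutes S" "\<And>i. i \<in> S \<Longrightarrow> x (\<sigma> i) = c * x i" "c \<noteq> 1"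
  shows "sum x S = 0"
proof -
  have "sum x S = (\<Sum>i\<in>S. x (\<sigma> i))"
    using sum.permute[OF assms(1), of x] by (simp add: o_def)
  also have "\<dots> = c * sum x S" by (simp add: assms(2) sum_distrib_left)
  finally have "(1 - c) * sum x S = 0" by (simp add: algebra_simps)
  then show ?thesis using \<open>c \<noteq> 1\<close> by simp
qed

text \<open>Factors 2 of the exponent can be removed one at a time, since a square root of 1 is 1 or
  -1 and the latter is excluded.\<close>

lemma power_odd_part_eq_1:
  fixes c :: "'a::field"
  assumes "c ^ k = 1" "k > 0" "\<And>w. c ^ w \<noteq> - 1"
  shows "c ^ odd_part k = 1"
proof -
  obtain t where t: "k = 2 ^ t * odd_part k"
    using odd_part_decompose[OF \<open>k > 0\<close>] by blast
  have "c ^ (2 ^ t * l) = 1 \<Longrightarrow> c ^ l = 1" for t l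
  proof (induction t)
    case (Suc t)
    then have "(c ^ (2 ^ t * l))\<^sup>2 = 1" by (simp flip: power_mult add: ac_simps)
    then show ?case using Suc.IH assms(3) by (auto simp: power2_eq_1_iff)
  qed simp
  then show ?thesis using t assms(1) by metis
qed

text \<open>If some power of \<open>c\<close> were \<open>-1\<close>, then \<open>x i\<close> and \<open>- x i\<close> would both be values of \<open>x\<close>.\<close>

lemma scaling_power_odd_part:
  fixes x :: "'i \<Rightarrow> 'a::field"
  assumes "\<sigma> permutes S" "\<And>i. i \<in> S \<Longrightarrow> x (\<sigma> i) = c * x i"
    and "finite S" "S \<noteq> {}" "\<And>i. i \<in> S \<Longrightarrow> x i \<noteq> 0"
    and "inj_on (\<lambda>i. (x i)\<^sup>2) S" "(2::'a) \<noteq> 0"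
  shows "c ^ odd_part (card S) = 1"
proof (rule power_odd_part_eq_1)
  \<comment> \<open>Reindexing the product of all values by \<open>\<sigma>\<close> multiplies it by
    \<open>c ^ card S\<close>.\<close>
  have "prod x S = (\<Prod>i\<in>S. x (\<sigma> i))"
    using prod.permute[OF assms(1), of x] by (simp add: o_def)
  also have "\<dots> = c ^ card S * prod x S" by (simp add: assms(2) prod.distrib)
  finally show "c ^ card S = 1" using assms(3,5) by simp
  show "card S > 0" using assms(3,4) by (simp add: card_gt_0_iff)
  fix w
  obtain i where i: "i \<in> S" using assms(4) by blast
  \<comment> \<open>Iterating \<open>\<sigma>\<close> realizes every power of \<open>c\<close> as a
    scaling within the family.\<close>
  have pow: "(\<sigma> ^^ w) i \<in> S \<and> x ((\<sigma> ^^ w) i) = c ^ w * x i"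
    by (induction w) (use i assms(1,2) in \<open>auto simp: permutes_in_image\<close>)
  show "c ^ w \<noteq> - 1"
  proof
    assume "c ^ w = - 1"
    then have neg: "x ((\<sigma> ^^ w) i) = - x i" using pow by simp
    then have "(\<sigma> ^^ w) i = i" using inj_onD[OF assms(6), of "(\<sigma> ^^ w) i" i] pow i by simp
    then have "2 * x i = 0" using neg by (simp add: algebra_simps eq_neg_iff_add_eq_0 flip: mult_2)
    then show False using assms(5,7) i by simp
  qed
qed

section \<open>Arrays with entries \<open>x i * y j\<close> and their multipliers\<close>

lemma elements_mat_conv_image:
  "A \<in> carrier_mat m n \<Longrightarrow> elements_mat A = (\<lambda>ij. A $$ ij) ` ({..<m} \<times> {..<n})"
  by (auto simp: elements_mat_def)

text \<open>Distinctness of the squares encodes that the entries are distinct up to sign.\<close>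

locale product_array =
  fixes m n :: nat and x y :: "nat \<Rightarrow> 'a::{finite, field}"
  assumes card_field: "card (UNIV :: 'a set) = 2 * m * n + 1"
    and nonzero: "x i \<noteq> 0" "y j \<noteq> 0"
    and squares_inj: "inj_on (\<lambda>(i, j). (x i * y j)\<^sup>2) ({..<m} \<times> {..<n})"
begin

definition A :: "'a mat" where "A = mat m n (\<lambda>(i, j). x i * y j)"

lemma A_carrier: "A \<in> carrier_mat m n" and dim_A [simp]: "dim_row A = m" "dim_col A = n"
  and A_index [simp]: "i < m \<Longrightarrow> j < n \<Longrightarrow> A $$ (i, j) = x i * y j"
  by (simp_all add: A_def)

lemma positive: "m > 0" "n > 0"
proof -
  have "card {0, 1 :: 'a} \<le> card (UNIV :: 'a set)" by (rule card_mono) auto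
  then show "m > 0" "n > 0" using card_field by (auto intro!: Nat.gr0I)
qed

text \<open>In characteristic 2 the only square root of 1 is 1, but there are two of them because 2
  divides the order \<open>2 * m * n\<close> of the multiplicative group.\<close>

lemma two_nonzero: "(2::'a) \<noteq> 0"
proof
  assume "(2::'a) = 0"
  then have "(1::'a) + 1 = 0" by simp
  then have "(- 1::'a) = 1" by (metis add_eq_0_iff)
  then have "{u::'a. u\<^sup>2 = 1} = {1}" by (auto simp: power2_eq_1_iff)
  moreover have "card {u::'a. u\<^sup>2 = 1} = 2"
    by (rule card_roots_of_unity[where e = "m * n"]) (simp add: card_field)
  ultimately show False by simp
qed

lemma squares_eqD:
  assumes "i < m" "j < n" "i' < m" "j' < n" "(x i * y j)\<^sup>2 = (x i' * y j')\<^sup>2"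
  shows "i = i'" "j = j'"
  using inj_onD[OF squares_inj, of "(i, j)" "(i', j')"] assms by auto

lemma x_inj: "inj_on x {..<m}" and y_inj: "inj_on y {..<n}"
  using squares_eqD[of _ 0 _ 0] squares_eqD[of 0 _ 0 _] positive
  by (auto intro!: inj_onI)

lemma entries_inj: "inj_on (\<lambda>ij. A $$ ij) ({..<m} \<times> {..<n})"
proof (rule inj_onI)
  fix p p' assume p: "p \<in> {..<m} \<times> {..<n}" "p' \<in> {..<m} \<times> {..<n}" "A $$ p = A $$ p'"
  obtain i j i' j' where "p = (i, j)" "p' = (i', j')" by fastforce
  with p show "p = p'"
    using squares_eqD[of i j i' j'] A_index[of i j] A_index[of i' j'] by auto
qed

text \<open>Distinct squares make the entries disjoint from their negatives; together these are
  \<open>2 * m * n\<close> nonzero elements, hence all of them.\<close>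

lemma half_set_entries: "half_set (elements_mat A)"
proof -
  let ?L = "elements_mat A"
  note L = elements_mat_conv_image[OF A_carrier]
  have card_L: "card ?L = m * n" unfolding L by (simp add: card_image entries_inj)
  have "?L \<inter> uminus ` ?L = {}"
  proof (rule ccontr)
    assume "?L \<inter> uminus ` ?L \<noteq> {}"
    then obtain i j i' j' where ij: "i < m" "j < n" "i' < m" "j' < n" "x i * y j = - (x i' * y j')"
      unfolding L by auto
    then have "i = i'" "j = j'" using squares_eqD[of i j i' j'] by simp_all
    then have "2 * (x i * y j) = 0" using ij(5) by simp
    then show False using nonzero two_nonzero by simp
  qed
  moreover have "finite ?L" by simp
  moreover have "card (uminus ` ?L) = card ?L" by (simp add: card_image)
  ultimately have "card (?L \<union> uminus ` ?L) = card (UNIV - {0::'a})"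
    by (simp add: card_Un_disjoint card_L card_Diff_singleton card_field)
  moreover have "?L \<union> uminus ` ?L \<subseteq> UNIV - {0}" using nonzero unfolding L by auto
  ultimately have "?L \<union> uminus ` ?L = UNIV - {0}" by (intro card_subset_eq) auto
  then show ?thesis unfolding half_set_def using card_L card_field by simp
qed

lemma heffter_array:
  assumes "sum x {..<m} = 0" "sum y {..<n} = 0"
  shows "heffter_array m n A"
  unfolding heffter_array_def
  using A_carrier entries_inj half_set_entries assms
  by (simp flip: sum_distrib_left sum_distrib_right)

lemma rank_one: "rank_one A"
proof -
  interpret vec_space "TYPE('a)" m .
  have "rank A \<le> 1" by (rule rank_le_1_product_entries[OF A_carrier]) simp
  moreover have "card {col A 0} \<le> rank A"
  proof (rule rank_ge_card_indpt[OF A_carrier])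
    show "{col A 0} \<subseteq> set (cols A)" using positive by (simp add: cols_def)
    have "col A 0 $ 0 \<noteq> 0\<^sub>v m $ 0" using positive nonzero by simp
    then have "col A 0 \<noteq> 0\<^sub>v m" by metis
    moreover have "col A 0 \<in> carrier_vec m" by (simp add: carrier_vecI)
    moreover have "lin_indpt {}" by (simp add: lin_dep_def)
    ultimately show "lin_indpt {col A 0}"
      using lin_dep_iff_in_span[of "{}" "col A 0"] span_empty by auto
  qed
  ultimately show ?thesis by (simp add: rank_one_def)
qed

text \<open>Two entries of one column of the scaled transpose would force two equal entries of
  \<open>A\<close> in columns 0 and 1.\<close>

lemma transpose_not_multiplier:
  assumes "m > 1" 
  shows "\<not> perm_rows_cols A (u \<cdot>\<^sub>m transpose_mat A)"
proof
  assume "perm_rows_cols A (u \<cdot>\<^sub>m transpose_mat A)"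
  then obtain \<sigma> \<tau> where perm: "\<sigma> permutes {..<m}" "\<tau> permutes {..<n}"
    and eq: "u \<cdot>\<^sub>m transpose_mat A = mat m n (\<lambda>(i, j). A $$ (\<sigma> i, \<tau> j))"
    by (auto simp: perm_rows_cols_def)
  have "m = n" using arg_cong[OF eq, of dim_row] by simp
  have lt: "\<sigma> i < m" "\<tau> i < m" if "i < m" for i
    using permutes_in_image[OF perm(1), of i] permutes_in_image[OF perm(2), of i] that \<open>m = n\<close> by auto
  have entry: "u * (x j * y i) = x (\<sigma> i) * y (\<tau> j)" if "i < m" "j < m" for i j
  proof -
    have "i < n" "j < n" "\<tau> j < n" using that lt[of j] unfolding \<open>m = n\<close> by auto
    then show ?thesis
      using arg_cong[OF eq, of "\<lambda>B. B $$ (i, j)"] that lt[of i] by simp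
  qed
  have "u \<noteq> 0" using entry[of 0 0] positive nonzero by auto
  \<comment> \<open>Both sides equal
    \<open>x (\<sigma> 0) * x (\<sigma> 1) * y (\<tau> 0)\<close>.\<close>
  have "(u * x 0) * (x (\<sigma> 0) * y 1) = (u * x 0) * (x (\<sigma> 1) * y 0)"
    using entry[of 0 0] entry[of 1 0] assms by (simp add: algebra_simps)
  then have "x (\<sigma> 0) * y 1 = x (\<sigma> 1) * y 0" using \<open>u \<noteq> 0\<close> nonzero by simp
  then show False
    using squares_eqD(2)[of "\<sigma> 0" 1 "\<sigma> 1" 0] lt assms \<open>m = n\<close> by simp
qed

text \<open>The variables separate: \<open>\<sigma>\<close> scales \<open>x\<close> by some
  \<open>c\<close>, \<open>\<tau>\<close> scales \<open>y\<close> by some \<open>d\<close>, and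
  \<open>u = c * d\<close>. Each factor is killed by the odd part of its dimension.\<close>

lemma multiplier_power:
  assumes "u \<noteq> 0" "perm_rows_cols A (u \<cdot>\<^sub>m A)"
  shows "u ^ lcm (odd_part m) (odd_part n) = 1"
proof -
  obtain \<sigma> \<tau> where perm: "\<sigma> permutes {..<m}" "\<tau> permutes {..<n}"
    and eq: "u \<cdot>\<^sub>m A = mat m n (\<lambda>(i, j). A $$ (\<sigma> i, \<tau> j))"
    using assms(2) by (auto simp: perm_rows_cols_def)
  have lt: "\<sigma> i < m" "\<tau> j < n" if "i < m" "j < n" for i j
    using permutes_in_image[OF perm(1), of i] permutes_in_image[OF perm(2), of j] that by auto
  have entry: "u * (x i * y j) = x (\<sigma> i) * y (\<tau> j)" if "i < m" "j < n" for i j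
    using arg_cong[OF eq, of "\<lambda>B. B $$ (i, j)"] that lt[of i j] by simp
  \<comment> \<open>Column 0 of the entry identity forces this value of \<open>c\<close>.\<close>
  define c where "c = u * y 0 / y (\<tau> 0)"
  define d where "d = y (\<tau> 0) / y 0"
  have u: "u = c * d" using nonzero by (simp add: c_def d_def)
  have c: "x (\<sigma> i) = c * x i" if "i \<in> {..<m}" for i
    using entry[of i 0] that positive nonzero by (simp add: c_def field_simps)
  have d: "y (\<tau> j) = d * y j" if "j \<in> {..<n}" for j
  proof -
    have "c * d * (x 0 * y j) = c * x 0 * y (\<tau> j)"
      using entry[of 0 j] that positive c[of 0] u by simp
    moreover have "c \<noteq> 0" using \<open>u \<noteq> 0\<close> u by auto
    ultimately show ?thesis using nonzero by (simp add: ac_simps)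
  qed
  have "inj_on (\<lambda>i. (x i)\<^sup>2) {..<m}" "inj_on (\<lambda>j. (y j)\<^sup>2) {..<n}"
    using squares_eqD[of _ 0 _ 0] squares_eqD[of 0 _ 0 _] positive
    by (auto intro!: inj_onI simp: power_mult_distrib)
  then have "c ^ odd_part m = 1" "d ^ odd_part n = 1"
    using scaling_power_odd_part[where x = x, OF perm(1) c]
      scaling_power_odd_part[where x = y, OF perm(2) d]
      positive nonzero two_nonzero by (auto simp: lessThan_empty_iff)
  moreover have "c ^ lcm (odd_part m) (odd_part n) = (c ^ odd_part m) ^ (lcm (odd_part m) (odd_part n) div odd_part m)"
    "d ^ lcm (odd_part m) (odd_part n) = (d ^ odd_part n) ^ (lcm (odd_part m) (odd_part n) div odd_part n)"
    by (simp_all flip: power_mult)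
  ultimately show ?thesis by (simp add: u power_mult_distrib)
qed

lemma multiplierI:
  assumes "\<alpha> \<noteq> 0" "\<And>i. i < m \<Longrightarrow> \<alpha> * x i \<in> x ` {..<m}"
    and "\<beta> \<noteq> 0" "\<And>j. j < n \<Longrightarrow> \<beta> * y j \<in> y ` {..<n}"
  shows "\<alpha> * \<beta> \<in> multipliers A"
proof -
  obtain \<sigma> where \<sigma>: "\<sigma> permutes {..<m}" "\<And>i. i \<in> {..<m} \<Longrightarrow> x (\<sigma> i) = \<alpha> * x i"
    using scaling_permutation[OF _ x_inj assms(1)] assms(2) by auto
  obtain \<tau> where \<tau>: "\<tau> permutes {..<n}" "\<And>j. j \<in> {..<n} \<Longrightarrow> y (\<tau> j) = \<beta> * y j"
    using scaling_permutation[OF _ y_inj assms(3)] assms(4) by auto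
  have lt: "\<sigma> i < m" "\<tau> j < n" if "i < m" "j < n" for i j
    using permutes_in_image[OF \<sigma>(1), of i] permutes_in_image[OF \<tau>(1), of j] that by auto
  have "(\<alpha> * \<beta>) \<cdot>\<^sub>m A = mat m n (\<lambda>(i, j). A $$ (\<sigma> i, \<tau> j))"
    by (rule eq_matI) (use lt \<sigma>(2) \<tau>(2) in \<open>auto simp: ac_simps\<close>)
  then have "perm_rows_cols A ((\<alpha> * \<beta>) \<cdot>\<^sub>m A)"
    unfolding perm_rows_cols_def using \<sigma>(1) \<tau>(1) by auto
  then show ?thesis using assms by (simp add: multipliers_def)
qed

end

section \<open>Exponents of the generator and unions of cosets\<close>

text \<open>A mixed-radix expansion: the residue modulo \<open>r * s\<close> determines
  \<open>I mod r\<close> and \<open>J mod s\<close>, and the quotient determines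
  \<open>I div r\<close> and \<open>J div s\<close> by the Chinese remainder theorem. The modulus is
  half the group order because squares of entries are compared.\<close>

lemma exponent_unique:
  fixes r s h k :: nat
  assumes "coprime h k" "odd h" "odd k" "I < r * h" "I' < r * h" "J < s * k" "J' < s * k"
    and "[(1 * (I mod r) + 2 * r * s * k * (I div r)) + (r * (J mod s) + 2 * r * s * h * (J div s))
        = (1 * (I' mod r) + 2 * r * s * k * (I' div r)) + (r * (J' mod s) + 2 * r * s * h * (J' div s))]
        (mod (r * s * (h * k)))" (is "[?E = ?E'] (mod _)")
  shows "I = I' \<and> J = J'"
proof -
  have pos: "r > 0" "s > 0" "h > 0" "k > 0" using assms by (auto intro!: Nat.gr0I)
  define i j a b where defs: "i = I mod r" "j = J mod s" "a = I div r" "b = J div s"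
  define i' j' a' b' where defs': "i' = I' mod r" "j' = J' mod s" "a' = I' div r" "b' = J' div s"
  have lt: "i < r" "i' < r" "j < s" "j' < s" "a < h" "a' < h" "b < k" "b' < k"
    unfolding defs defs' using pos assms(4-7)
    by (auto simp: less_mult_imp_div_less mult.commute)
  have E: "?E = (i + r * j) + r * s * (2 * (k * a + h * b))"
    unfolding defs by (simp add: algebra_simps)
  have E': "?E' = (i' + r * j') + r * s * (2 * (k * a' + h * b'))"
    unfolding defs' by (simp add: algebra_simps)
  have cong: "[(i + r * j) + r * s * (2 * (k * a + h * b))
      = (i' + r * j') + r * s * (2 * (k * a' + h * b'))] (mod (r * s * (h * k)))"
    using assms(8) unfolding E E' .
  have bound: "i + r * j < r * s" if "i < r" "j < s" for i j
  proof -
    have "i + r * j < r * Suc j" using that by simp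
    also have "\<dots> \<le> r * s" using that by (intro mult_le_mono2) simp
    finally show ?thesis .
  qed
  have "[(i + r * j) + r * s * (2 * (k * a + h * b))
      = (i' + r * j') + r * s * (2 * (k * a' + h * b'))] (mod (r * s))"
    using cong_modulus_mult_nat[OF cong] .
  then have *: "i + r * j = i' + r * j'"
    using bound lt by (simp add: cong_def)
  then have "(i + r * j) mod r = (i' + r * j') mod r" by simp
  then have ii: "i = i'" using lt by simp
  then have jj: "j = j'" using * pos by simp
  have "[r * s * (2 * (k * a + h * b)) = r * s * (2 * (k * a' + h * b'))] (mod (r * s * (h * k)))"
    using cong unfolding * by (simp add: cong_add_lcancel_nat)
  then have "r * s * (2 * (k * a + h * b) mod (h * k)) = r * s * (2 * (k * a' + h * b') mod (h * k))"
    unfolding cong_def mult_mod_right .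
  then have "[2 * (k * a + h * b) = 2 * (k * a' + h * b')] (mod (h * k))"
    using pos by (simp add: cong_def)
  \<comment> \<open>The factor 2 cancels because \<open>h * k\<close> is odd.\<close>
  then have c: "[k * a + h * b = k * a' + h * b'] (mod (h * k))"
    using assms(2,3) by (subst (asm) cong_mult_lcancel_nat) auto
  \<comment> \<open>Modulo \<open>h\<close> the term with \<open>b\<close> vanishes and
    \<open>k\<close> is invertible; modulo \<open>k\<close> the roles are exchanged.\<close>
  have "[k * a + h * b = k * a' + h * b'] (mod h)" using cong_modulus_mult_nat[OF c] .
  then have "[k * a = k * a'] (mod h)" by (simp add: cong_def)
  then have "[a = a'] (mod h)"
    using assms(1) by (subst (asm) cong_mult_lcancel_nat) (auto simp: coprime_commute)
  then have aa: "a = a'" using lt by (simp add: cong_def)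
  have "[k * a + h * b = k * a' + h * b'] (mod k)"
    using cong_modulus_mult_nat[of _ _ k h] c by (simp add: mult.commute)
  then have "[h * b = h * b'] (mod k)" by (simp add: cong_def)
  then have "[b = b'] (mod k)"
    using assms(1) by (subst (asm) cong_mult_lcancel_nat) auto
  then have "b = b'" using lt by (simp add: cong_def)
  with ii jj aa show ?thesis
    unfolding defs defs' by (metis mult_div_mod_eq)
qed

text \<open>The values at \<open>I = i + r * a\<close> with \<open>i < r\<close>, \<open>a < h\<close> form the union of the cosets of
  \<open>\<langle>g ^ e\<rangle>\<close> represented by the \<open>g ^ (d * i)\<close>.\<close>

definition coset_union :: "'a::field \<Rightarrow> nat \<Rightarrow> nat \<Rightarrow> nat \<Rightarrow> nat \<Rightarrow> 'a" where
  "coset_union g d e r I = g ^ (d * (I mod r) + e * (I div r))"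

text \<open>Multiplication by \<open>g ^ (e * t)\<close> keeps the representative
  \<open>I mod r\<close> and shifts \<open>I div r\<close> cyclically modulo
  \<open>h\<close>.\<close>

lemma coset_union_closed:
  assumes "g ^ (e * h) = 1" "I < r * h"
  shows "g ^ (e * t) * coset_union g d e r I \<in> coset_union g d e r ` {..<r * h}"
proof -
  have pos: "r > 0" "h > 0" using assms(2) by (auto intro!: Nat.gr0I)
  define a where "a = (I div r + t) mod h"
  have "a < h" using pos by (simp add: a_def)
  have "I mod r + r * a < r * Suc a" using pos by simp
  also have "\<dots> \<le> r * h" using \<open>a < h\<close> by (intro mult_le_mono2) simp
  finally have lt: "I mod r + r * a < r * h" .
  have "(g ^ e) ^ a = (g ^ e) ^ (t + I div r)"
    by (rule power_eq_power_cong[where n = h])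
       (use assms(1) in \<open>simp_all add: a_def cong_def power_mult add.commute\<close>)
  then have "g ^ (e * a) = g ^ (e * t) * g ^ (e * (I div r))"
    by (simp add: power_mult power_add)
  then have "coset_union g d e r (I mod r + r * a) = g ^ (e * t) * coset_union g d e r I"
    using pos by (simp add: coset_union_def power_add)
  then show ?thesis using lt by (metis image_eqI lessThan_iff)
qed

lemma sum_coset_union_eq_0:
  fixes g :: "'a::field"
  assumes "g ^ (e * h) = 1" "g ^ e \<noteq> 1" "g \<noteq> 0" "inj_on (coset_union g d e r) {..<r * h}"
  shows "sum (coset_union g d e r) {..<r * h} = 0"
proof -
  have "g ^ e * coset_union g d e r I \<in> coset_union g d e r ` {..<r * h}" if "I \<in> {..<r * h}" for I
    using coset_union_closed[OF assms(1), of I r 1 d] that by simp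
  then obtain \<sigma> where "\<sigma> permutes {..<r * h}"
    "\<And>I. I \<in> {..<r * h} \<Longrightarrow> coset_union g d e r (\<sigma> I) = g ^ e * coset_union g d e r I"
    using scaling_permutation[OF _ assms(4), of "g ^ e"] assms(3) by auto
  then show ?thesis using assms(2) by (rule sum_eq_0_if_scaling)
qed

text \<open>The Chinese remainder theorem gives exponents with \<open>v + w\<close> congruent to 1
  modulo \<open>h * k\<close>, \<open>k\<close> dividing \<open>v\<close> and \<open>h\<close>
  dividing \<open>w\<close>; then \<open>u ^ v\<close> and \<open>u ^ w\<close> are the
  factors.\<close>

lemma root_of_unity_coprime_factorization:
  fixes u :: "'a::field"
  assumes "coprime h k" "u ^ (h * k) = 1"
  obtains \<alpha> \<beta> where "\<alpha> ^ h = 1" "\<beta> ^ k = 1" "u = \<alpha> * \<beta>"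
proof -
  obtain v where v: "[v = 1] (mod h)" "[v = 0] (mod k)"
    using binary_chinese_remainder_nat[OF assms(1)] by blast
  obtain w where w: "[w = 0] (mod h)" "[w = 1] (mod k)"
    using binary_chinese_remainder_nat[OF assms(1)] by blast
  have "[v + w = 1] (mod (h * k))"
    using cong_add[OF v(1) w(1)] cong_add[OF v(2) w(2)] assms(1)
    by (intro coprime_cong_mult_nat) simp_all
  then have "u ^ (v + w) = u ^ 1" by (rule power_eq_power_cong[OF assms(2)])
  then have "u = u ^ v * u ^ w" by (simp add: power_add)
  moreover have "[v * h = 0] (mod (h * k))" "[w * k = 0] (mod (h * k))"
    using v(2) w(1) by (auto simp: cong_0_iff mult.commute)
  then have "u ^ (v * h) = u ^ 0" "u ^ (w * k) = u ^ 0"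
    using power_eq_power_cong[OF assms(2)] by blast+
  then have "(u ^ v) ^ h = 1" "(u ^ w) ^ k = 1" by (simp_all add: power_mult)
  ultimately show thesis using that by simp
qed

section \<open>Construction of the optimal array\<close>

theorem theorem3:
  fixes m n q :: nat
  assumes "m \<ge> 3" and "n \<ge> 3"
    and "q = 2 * m * n + 1" and "primepow q"
    and "card (UNIV :: 'a::{finite, field} set) = q"
    and "\<exists>p p'. prime p \<and> prime p' \<and> odd p \<and> odd p' \<and> p \<noteq> p' \<and> p dvd m \<and> p' dvd n"
    and "\<not> odd_part m * rad (odd_part m) dvd odd_part n"
    and "\<not> odd_part n * rad (odd_part n) dvd odd_part m"
  shows "\<exists>A :: 'a mat. heffter_array m n A \<and> rank_one A \<and>
           card (multipliers A) = lcm (odd_part m) (odd_part n)"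
proof -
  let ?M = "odd_part m" and ?K = "odd_part n"
  obtain c where c: "m = 2 ^ c * ?M" "odd ?M" using odd_part_decompose[of m] assms(1) by auto
  obtain d where d: "n = 2 ^ d * ?K" "odd ?K" using odd_part_decompose[of n] assms(2) by auto
  obtain p p' where p: "prime p" "prime p'" "odd p" "odd p'" "p \<noteq> p'" "p dvd m" "p' dvd n"
    using assms(6) by blast
  have odd_dvd: "a dvd l" if "odd a" "a dvd 2 ^ t * l" for a l t :: nat
  proof -
    have "coprime a (2 ^ t)" using that(1) by simp
    then show ?thesis using that(2) by (simp add: coprime_dvd_mult_right_iff)
  qed
  have "p dvd ?M" "p' dvd ?K"
    using p c(1) d(1) odd_dvd[of p c ?M] odd_dvd[of p' d ?K] by simp_all
  then obtain h k where hk: "h dvd ?M" "k dvd ?K" "coprime h k" "h * k = lcm ?M ?K" "h > 1" "k > 1"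
    using coprime_factorization_of_lcm[OF odd_pos odd_pos assms(7,8) p(1,2,5)] c(2) d(2) by blast
  have "odd h" "odd k" using hk(1,2) c(2) d(2) dvd_trans by blast+
  have "h dvd m" "k dvd n" using hk(1,2) c(1) d(1) by (metis dvd_mult)+
  then obtain r s where rs: "m = r * h" "n = s * k" by (metis dvd_def mult.commute)

  obtain g :: 'a where g: "g \<noteq> 0" "\<forall>x. x \<noteq> 0 \<longrightarrow> (\<exists>i. x = g ^ i)"
    using finite_field_generator by blast
  \<comment> \<open>These are \<open>(q - 1) / h\<close> and \<open>(q - 1) / k\<close>, so
    \<open>g ^ e\<close> and \<open>g ^ f\<close> generate the \<open>h\<close>-th and
    \<open>k\<close>-th roots of unity.\<close>
  define e where "e = 2 * r * s * k"
  define f where "f = 2 * r * s * h"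
  have N: "2 * m * n = e * h" "2 * m * n = f * k"
    unfolding e_def f_def rs by simp_all
  have card: "card (UNIV :: 'a set) = Suc (2 * m * n)" using assms(3,5) by simp
  note card_e = card[unfolded N(1)] and card_f = card[unfolded N(2)]
  note g_eq_iff = generator_power_eq_iff[OF g card]
  define x where "x = coset_union g 1 e r"
  define y where "y = coset_union g r f s"

  interpret product_array m n x y
  proof
    show "card (UNIV :: 'a set) = 2 * m * n + 1" using card by simp
    show "x i \<noteq> 0" "y i \<noteq> 0" for i using g(1) by (simp_all add: x_def y_def coset_union_def)
    show "inj_on (\<lambda>(i, j). (x i * y j)\<^sup>2) ({..<m} \<times> {..<n})"
    proof (rule inj_onI)
      fix P P' assume P: "P \<in> {..<m} \<times> {..<n}" "P' \<in> {..<m} \<times> {..<n}"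
        "(case P of (i, j) \<Rightarrow> (x i * y j)\<^sup>2) = (case P' of (i, j) \<Rightarrow> (x i * y j)\<^sup>2)"
      obtain I J I' J' where IJ: "P = (I, J)" "P' = (I', J')" by fastforce
      have lt: "I \<in> {..<m}" "J \<in> {..<n}" "I' \<in> {..<m}" "J' \<in> {..<n}"
        and eq: "(x I * y J)\<^sup>2 = (x I' * y J')\<^sup>2"
        using P unfolding IJ by auto
      define E where "E I J = (1 * (I mod r) + e * (I div r)) + (r * (J mod s) + f * (J div s))" for I J
      have "(x I * y J)\<^sup>2 = g ^ (2 * E I J)" for I J
        by (simp add: x_def y_def coset_union_def E_def mult.commute flip: power_add power_mult)
      \<comment> \<open>Equality of squares is a congruence of doubled exponents modulo
        \<open>q - 1\<close>; halving it gives the modulus \<open>r * s * (h * k)\<close>.\<close>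
      then have "[2 * E I J = 2 * E I' J'] (mod (2 * (r * s * (h * k))))"
        using eq g_eq_iff by (simp add: rs ac_simps)
      then have "[E I J = E I' J'] (mod (r * s * (h * k)))"
        by (simp add: cong_def flip: mult_mod_right)
      then have "I = I' \<and> J = J'"
        unfolding E_def e_def f_def
        by (intro exponent_unique[OF hk(3) \<open>odd h\<close> \<open>odd k\<close>]) (use lt rs in auto)
      then show "P = P'" unfolding IJ by simp
    qed
  qed

  have "2 * m * n = 2 * r * s * (h * k)" unfolding rs by simp
  note N_lcm = this[unfolded hk(4)]
  have ord: "g ^ (e * h) = 1" "g ^ (f * k) = 1"
    using power_card_minus_1[OF g(1)] card by (simp_all flip: N)
  \<comment> \<open>The exponent \<open>i\<close> lies strictly between 0 and \<open>q - 1\<close>.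
    This gives \<open>g ^ e\<close> and \<open>g ^ f\<close> different from 1, as the vanishing sums
    require.\<close>
  have root: "l > 1 \<Longrightarrow> 2 * m * n = i * l \<Longrightarrow> g ^ i \<noteq> 1" for i l
  proof
    assume l: "l > 1" "2 * m * n = i * l" and "g ^ i = 1"
    then have "i * l dvd i" using g_eq_iff[of i 0] by (simp add: cong_0_iff)
    moreover have "i > 0" using l assms(1,2) by (auto intro!: Nat.gr0I)
    ultimately show False using l(1) by (simp add: dvd_imp_le)
  qed
  have "sum x {..<m} = 0"
    unfolding x_def rs(1) using ord root[OF hk(5) N(1)] g(1) x_inj
    by (intro sum_coset_union_eq_0) (simp_all add: x_def rs)
  moreover have "sum y {..<n} = 0"
    unfolding y_def rs(2) using ord root[OF hk(6) N(2)] g(1) y_inj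
    by (intro sum_coset_union_eq_0) (simp_all add: y_def rs)
  ultimately have "heffter_array m n A" by (rule heffter_array)

  moreover have "multipliers A = {u. u ^ lcm ?M ?K = 1}"
  proof (intro equalityI subsetI)
    fix u assume "u \<in> multipliers A"
    then show "u \<in> {u. u ^ lcm ?M ?K = 1}"
      using multiplier_power transpose_not_multiplier assms(1) by (auto simp: multipliers_def)
  next
    fix u :: 'a assume "u \<in> {u. u ^ lcm ?M ?K = 1}"
    then obtain \<alpha> \<beta> where \<alpha>\<beta>: "\<alpha> ^ h = 1" "\<beta> ^ k = 1" "u = \<alpha> * \<beta>"
      using root_of_unity_coprime_factorization[OF hk(3)] unfolding hk(4) by blast
    \<comment> \<open>As powers of \<open>g ^ e\<close> and \<open>g ^ f\<close>, the two factors
      stabilize the value sets of \<open>x\<close> and \<open>y\<close>.\<close>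
    obtain a b where ab: "\<alpha> = g ^ (e * a)" "\<beta> = g ^ (f * b)"
      using \<alpha>\<beta> root_of_unity_iff_generator_power[OF g card_e] hk(5)
        root_of_unity_iff_generator_power[OF g card_f] hk(6) by fastforce
    show "u \<in> multipliers A"
      unfolding \<alpha>\<beta>(3) ab
      using coset_union_closed[OF ord(1)] coset_union_closed[OF ord(2)] g(1)
      by (intro multiplierI) (simp_all add: x_def y_def rs)
  qed
  moreover have "card {u :: 'a. u ^ lcm ?M ?K = 1} = lcm ?M ?K"
    by (rule card_roots_of_unity) (simp only: card N_lcm)
  ultimately show ?thesis using rank_one by auto
qed

end
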